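(* Let $\alpha,\gamma\vDash n$ with $\gamma\le_\ell\alpha$ (lexicographic order). Then \[K^*_{\alpha,\gamma}=\sum_{\beta\succcurlyeq\gamma}L_{\alpha,\beta^c}=\sum_{\beta\succcurlyeq\gamma}L^*_{\alpha,\beta},\] where both sums run over compositions $\beta$ of $n$ that are coarsenings of $\gamma$.
   Context: For a composition $\alpha\vDash n$: its diagram has $\alpha_i$ left-justified boxes in row $i$, row 1 at the bottom. A row-strict immaculate tableau of shape $\alpha$ is a filling with positive integers whose leftmost column weakly increases bottom to top and whose rows strictly increase left to right; it has content $\gamma=(\gamma_1,\dots,\gamma_m)$ if it contains exactly $\gamma_i$ entries equal to $i$ for each $i$. $K^*_{\alpha,\gamma}$ is the number of row-strict immaculate tableaux of shape $\alpha$ and content $\gamma$. A standard immaculate tableau of shape $\alpha$ is a filling with $1,\dots,n$ each used once, leftmost column increasing bottom to top and rows increasing left to right. For such $T$, $\mathrm{Des}_{\mathfrak S^*}(T)=\{i: i+1 \text{ is strictly above } i\}$ and $\mathrm{Des}_{\mathcal R\mathfrak S^*}(T)=\{i:i+1\text{ is weakly below } i\}$. For $D=\{s_1<\dots<s_j\}\subseteq\{1,\dots,n-1\}$, $\mathrm{comp}(D)=(s_1,s_2-s_1,\dots,n-s_j)$, with inverse $\mathrm{set}$. $L_{\alpha,\beta}$ (resp. $L^*_{\alpha,\beta}$) is the number of standard immaculate tableaux $T$ of shape $\alpha$ with $\mathrm{comp}(\mathrm{Des}_{\mathfrak S^*}(T))=\beta$ (resp. $\mathrm{comp}(\mathrm{Des}_{\mathcal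 R\mathfrak S^*}(T))=\beta$). $\beta^c=\mathrm{comp}(\{1,\dots,n-1\}\setminus\mathrm{set}(\beta))$. $\beta\succcurlyeq\gamma$ means each part of $\beta$ is a sum of consecutive parts of $\gamma$. *)

theory Defs
  imports "HOL-Library.FuncSet"
begin

definition composition :: "nat \<Rightarrow> nat list \<Rightarrow> bool" where
  "composition n \<alpha> \<longleftrightarrow> (\<forall>a\<in>set \<alpha>. 0 < a) \<and> sum_list \<alpha> = n"

text \<open>The case \<open>n = 0\<close> is separate because the only composition of \<open>0\<close> is the empty one.\<close>

definition comp_of :: "nat \<Rightarrow> nat set \<Rightarrow> nat list" where
  "comp_of n D =
    (if n = 0 then []
     else let s = sorted_list_of_set D in map2 (-) (s @ [n]) (0 # s))"

definition set_of :: "nat list \<Rightarrow> nat set" where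
  "set_of \<beta> = {sum_list (take k \<beta>) | k. 1 \<le> k \<and> k < length \<beta>}"

lemma comp_of_set_of:
  assumes "composition n \<beta>" shows "comp_of n (set_of \<beta>) = \<beta>"
proof (cases "n = 0")
  case True
  then show ?thesis using assms by (cases \<beta>) (auto simp: composition_def comp_of_def)
next
  case False
  let ?f = "\<lambda>k. sum_list (take k \<beta>)"
  let ?s = "map ?f [1..<length \<beta>]"
  have step: "?f (Suc k) = ?f k + \<beta> ! k" if "k < length \<beta>" for k
    using that by (simp add: take_Suc_conv_app_nth)
  have lt: "?f i < ?f j" if "i < j" "j \<le> length \<beta>" for i j
    using that
  proof (induction j)
    case (Suc j)
    have "0 < \<beta> ! j" using assms Suc.prems by (auto simp: composition_def)
    then show ?case using Suc step[of j] by (cases "i = j") auto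
  qed simp
  have "sorted_wrt (<) ?s"
    by (auto simp: sorted_wrt_iff_nth_less intro!: lt)
  then have "sorted_list_of_set (set ?s) = ?s"
    using sorted_list_of_set.idem_if_sorted_distinct strict_sorted_iff by blast
  moreover have "set ?s = set_of \<beta>" by (auto simp: set_of_def image_iff)
  ultimately have s: "sorted_list_of_set (set_of \<beta>) = ?s" by simp
  have ne: "\<beta> \<noteq> []" using assms False by (auto simp: composition_def)
  have "map2 (-) (?s @ [n]) (0 # ?s) = \<beta>"
  proof (rule nth_equalityI)
    show "length (map2 (-) (?s @ [n]) (0 # ?s)) = length \<beta>" using ne by (cases \<beta>) (auto simp: Suc_le_eq)
  next
    fix i assume "i < length (map2 (-) (?s @ [n]) (0 # ?s))"
    then have i: "i < length \<beta>" using ne by (cases \<beta>) (auto simp: Suc_le_eq simp del: upt_Suc)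
    have a: "(?s @ [n]) ! i = ?f (Suc i)"
    proof (cases "Suc i < length \<beta>")
      case True
      then have "i < length \<beta> - Suc 0" by linarith
      then show ?thesis by (simp add: nth_append)
    next
      case False
      then have "length \<beta> = Suc i" using i by simp
      then show ?thesis using assms by (simp add: nth_append composition_def del: upt_Suc)
    qed
    have b: "(0 # ?s) ! i = ?f i" using i by (cases i) auto
    show "map2 (-) (?s @ [n]) (0 # ?s) ! i = \<beta> ! i"
      using i a b step[OF i] by (simp del: take_Suc upt_Suc)
  qed
  then show ?thesis using False by (simp add: comp_of_def s Let_def)
qed

lemma set_of_comp_of:
  assumes "D \<subseteq> {1..<n}" shows "composition n (comp_of n D) \<and> set_of (comp_of n D) = D"
proof (cases "n = 0")
  case True
  then show ?thesis using assms by (auto simp: composition_def comp_of_def set_of_def)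
next
  case False
  define s where "s = sorted_list_of_set D"
  have fin: "finite D" using assms finite_subset by blast
  have ss: "set s = D" using fin by (simp add: s_def)
  have srt: "sorted_wrt (<) (0 # s @ [n])"
    using assms fin ss False by (auto simp: s_def sorted_wrt_append)
  let ?c = "map2 (-) (s @ [n]) (0 # s)"
  have c: "comp_of n D = ?c" using False by (simp add: comp_of_def s_def Let_def)
  have len: "length ?c = Suc (length s)" by simp
  have nthc: "?c ! i = (0 # s @ [n]) ! Suc i - (0 # s @ [n]) ! i" if "i \<le> length s" for i
    using that by (cases i) (auto simp: nth_append)
  have inc: "(0 # s @ [n]) ! i < (0 # s @ [n]) ! Suc i" if "i \<le> length s" for i
    using srt that unfolding sorted_wrt_iff_nth_less by (metis length_Cons length_append_singleton lessI less_Suc_eq_le Suc_less_eq)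
  have part: "sum_list (take k ?c) = (0 # s @ [n]) ! k" if "k \<le> Suc (length s)" for k
    using that
  proof (induction k)
    case (Suc k)
    have "sum_list (take (Suc k) ?c) = sum_list (take k ?c) + ?c ! k"
      using Suc.prems by (subst take_Suc_conv_app_nth) auto
    then show ?case using Suc nthc[of k] inc[of k] by auto
  qed simp
  have "sum_list ?c = n" using part[of "Suc (length s)"] by (simp add: nth_append)
  moreover have "\<forall>a\<in>set ?c. 0 < a"
    using nthc inc by (metis in_set_conv_nth len less_Suc_eq_le zero_less_diff)
  moreover have "set_of ?c = set s"
  proof -
    have "set_of ?c = {(0 # s @ [n]) ! k |k. 1 \<le> k \<and> k < Suc (length s)}"
      unfolding set_of_def len using part by (metis (mono_tags, lifting) less_imp_le)
    also have "\<dots> = {s ! k |k. k < length s}"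
    proof (intro set_eqI iffI)
      fix x assume "x \<in> {(0 # s @ [n]) ! k |k. 1 \<le> k \<and> k < Suc (length s)}"
      then obtain k where "x = (0 # s @ [n]) ! k" "1 \<le> k" "k < Suc (length s)" by blast
      then show "x \<in> {s ! k |k. k < length s}" by (cases k) (auto simp: nth_append)
    next
      fix x assume "x \<in> {s ! k |k. k < length s}"
      then obtain k where "x = s ! k" "k < length s" by blast
      then show "x \<in> {(0 # s @ [n]) ! k |k. 1 \<le> k \<and> k < Suc (length s)}"
        by (auto intro!: exI[of _ "Suc k"] simp: nth_append)
    qed
    finally show ?thesis by (simp add: set_conv_nth)
  qed
  ultimately show ?thesis by (simp add: c ss composition_def)
qed

definition comp_complement :: "nat list \<Rightarrow> nat list" where
  "comp_complement \<beta> = (let n = sum_list \<beta> in comp_of n ({1..<n} - set_of \<beta>))"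

text \<open>The blocks \<open>gs\<close> are the runs of consecutive parts of \<open>\<gamma>\<close> that are added up.\<close>

definition coarsening :: "nat list \<Rightarrow> nat list \<Rightarrow> bool" (infix "\<succcurlyeq>\<^sub>c" 50) where
  "\<beta> \<succcurlyeq>\<^sub>c \<gamma> \<longleftrightarrow> (\<exists>gs. concat gs = \<gamma> \<and> [] \<notin> set gs \<and> map sum_list gs = \<beta>)"

text \<open>Cells are pairs (row, column), counted from \<open>0\<close>; row \<open>0\<close> is the bottom row, so larger row
  indices are higher up.\<close>

definition diagram :: "nat list \<Rightarrow> (nat \<times> nat) set" where
  "diagram \<alpha> = (SIGMA r:{..<length \<alpha>}. {..<\<alpha> ! r})"

definition rows_strict :: "nat list \<Rightarrow> (nat \<times> nat \<Rightarrow> nat) \<Rightarrow> bool" where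
  "rows_strict \<alpha> T \<longleftrightarrow>
    (\<forall>r c d. (r, c) \<in> diagram \<alpha> \<longrightarrow> (r, d) \<in> diagram \<alpha> \<longrightarrow> c < d \<longrightarrow> T (r, c) < T (r, d))"

text \<open>Fillings are extensional functions (\<open>undefined\<close> off the diagram), so that distinct functions
  are distinct tableaux.\<close>

definition row_strict_immaculate :: "nat list \<Rightarrow> (nat \<times> nat \<Rightarrow> nat) set" where
  "row_strict_immaculate \<alpha> =
    {T \<in> diagram \<alpha> \<rightarrow>\<^sub>E {1..}.
       (\<forall>r s. (r, 0) \<in> diagram \<alpha> \<longrightarrow> (s, 0) \<in> diagram \<alpha> \<longrightarrow> r < s \<longrightarrow> T (r, 0) \<le> T (s, 0)) \<and>
       rows_strict \<alpha> T}"

definition has_content :: "nat list \<Rightarrow> (nat \<times> nat \<Rightarrow> nat) \<Rightarrow> nat list \<Rightarrow> bool" where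
  "has_content \<alpha> T \<gamma> \<longleftrightarrow>
    (\<forall>i\<ge>1. card {x \<in> diagram \<alpha>. T x = i} = (if i \<le> length \<gamma> then \<gamma> ! (i - 1) else 0))"

definition K_star :: "nat list \<Rightarrow> nat list \<Rightarrow> nat" where
  "K_star \<alpha> \<gamma> = card {T \<in> row_strict_immaculate \<alpha>. has_content \<alpha> T \<gamma>}"

definition standard_immaculate :: "nat list \<Rightarrow> (nat \<times> nat \<Rightarrow> nat) set" where
  "standard_immaculate \<alpha> =
    {T \<in> extensional (diagram \<alpha>). bij_betw T (diagram \<alpha>) {1..sum_list \<alpha>} \<and>
       (\<forall>r s. (r, 0) \<in> diagram \<alpha> \<longrightarrow> (s, 0) \<in> diagram \<alpha> \<longrightarrow> r < s \<longrightarrow> T (r, 0) < T (s, 0)) \<and>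
       rows_strict \<alpha> T}"

definition Des_S :: "nat list \<Rightarrow> (nat \<times> nat \<Rightarrow> nat) \<Rightarrow> nat set" where
  "Des_S \<alpha> T =
    {i. \<exists>x\<in>diagram \<alpha>. \<exists>y\<in>diagram \<alpha>. T x = i \<and> T y = i + 1 \<and> fst x < fst y}"

definition Des_RS :: "nat list \<Rightarrow> (nat \<times> nat \<Rightarrow> nat) \<Rightarrow> nat set" where
  "Des_RS \<alpha> T =
    {i. \<exists>x\<in>diagram \<alpha>. \<exists>y\<in>diagram \<alpha>. T x = i \<and> T y = i + 1 \<and> fst y \<le> fst x}"

definition L_num :: "nat list \<Rightarrow> nat list \<Rightarrow> nat" where
  "L_num \<alpha> \<beta> = card {T \<in> standard_immaculate \<alpha>. comp_of (sum_list \<alpha>) (Des_S \<alpha> T) = \<beta>}"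

definition L_star :: "nat list \<Rightarrow> nat list \<Rightarrow> nat" where
  "L_star \<alpha> \<beta> = card {T \<in> standard_immaculate \<alpha>. comp_of (sum_list \<alpha>) (Des_RS \<alpha> T) = \<beta>}"

end

theory Submission
  imports Defs
begin

text \<open>Replacing the entries of a standard immaculate tableau that lie in the \<open>i\<close>-th block of \<open>\<gamma>\<close> by
  \<open>i\<close> is undone by numbering equal entries from bottom to top, which is the only numbering
  compatible with the weakly increasing first column. A block may be merged exactly when its entries
  move strictly upwards, i.e. when it contains no descent in its interior. Hence \<open>K\<^sup>*\<close> counts the
  standard tableaux whose row-strict descent set is contained in \<open>set(\<gamma>)\<close>. Grouping these by descent
  set gives the second sum, since \<open>\<beta> \<succcurlyeq> \<gamma>\<close> means \<open>set(\<beta>) \<subseteq> set(\<gamma>)\<close>; the first one follows because the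
  two kinds of descent sets are complementary.\<close>

section \<open>Compositions\<close>

abbreviation psum :: "nat list \<Rightarrow> nat \<Rightarrow> nat" where
  "psum \<gamma> k \<equiv> sum_list (take k \<gamma>)"

lemma psum_mono: "i \<le> j \<Longrightarrow> psum \<gamma> i \<le> psum \<gamma> j"
  by (auto simp: le_iff_add take_add)

lemma psum_le: "psum \<gamma> k \<le> sum_list \<gamma>"
  using psum_mono[of k "max k (length \<gamma>)" \<gamma>] by simp

lemma psum_Suc: "psum \<gamma> (Suc k) = psum \<gamma> k + (if k < length \<gamma> then \<gamma> ! k else 0)"
  by (simp add: take_Suc_conv_app_nth)

lemma psum_pos:
  assumes "\<forall>a\<in>set \<gamma>. 0 < a" "0 < k" "0 < length \<gamma>"
  shows "0 < psum \<gamma> k"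
  using assms by (cases \<gamma>; cases k) auto

lemma psum_strict_mono:
  assumes "\<forall>a\<in>set \<gamma>. 0 < a" "i < j" "i < length \<gamma>"
  shows "psum \<gamma> i < psum \<gamma> j"
proof -
  have "psum \<gamma> i < psum \<gamma> (Suc i)" using assms by (simp add: psum_Suc)
  also have "\<dots> \<le> psum \<gamma> j" using assms by (intro psum_mono) simp
  finally show ?thesis .
qed

lemma set_of_subset:
  assumes "composition n \<beta>" shows "set_of \<beta> \<subseteq> {1..<n}"
proof
  fix s assume "s \<in> set_of \<beta>"
  then obtain k where k: "s = psum \<beta> k" "1 \<le> k" "k < length \<beta>" by (auto simp: set_of_def)
  have "0 < s" using k assms psum_pos[of \<beta> k] by (cases \<beta>) (auto simp: composition_def)
  moreover have "s < n" using k assms psum_strict_mono[of \<beta> k "length \<beta>"]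
    by (auto simp: composition_def)
  ultimately show "s \<in> {1..<n}" by simp
qed

section \<open>Coarsening as inclusion of sets of partial sums\<close>

lemma sum_list_concat_map: "sum_list (concat gs) = sum_list (map sum_list gs)"
  by (induction gs) auto

text \<open>The first \<open>k\<close> blocks concatenate to a prefix of \<open>\<gamma>\<close>
  with the same sum. As no block is empty, this prefix is nonempty and proper, so its length is the
  required index into \<open>\<gamma>\<close>.\<close>

lemma coarsening_imp_set_of_subset:
  assumes "\<beta> \<succcurlyeq>\<^sub>c \<gamma>" shows "set_of \<beta> \<subseteq> set_of \<gamma>"
proof
  fix s assume "s \<in> set_of \<beta>"
  then obtain k where k: "s = psum \<beta> k" "1 \<le> k" "k < length \<beta>" by (auto simp: set_of_def)
  obtain gs where gs: "concat gs = \<gamma>" "[] \<notin> set gs" "map sum_list gs = \<beta>"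
    using assms by (auto simp: coarsening_def)
  have kl: "k < length gs" using k gs by auto
  have \<gamma>: "\<gamma> = concat (take k gs) @ concat (drop k gs)"
    by (simp flip: concat_append add: gs)
  have ne: "concat (take k gs) \<noteq> []"
    using gs k kl by (cases gs; cases k) auto
  have "concat (drop k gs) \<noteq> []"
    using gs kl by (metis Cons_nth_drop_Suc append_is_Nil_conv concat.simps(2) nth_mem)
  then have "length (concat (take k gs)) < length \<gamma>"
    using \<gamma> by (metis append_Nil2 length_append length_greater_0_conv less_add_same_cancel1)
  moreover have "s = psum \<gamma> (length (concat (take k gs)))"
    using k gs \<gamma> by (metis append_eq_conv_conj sum_list_concat_map take_map)
  ultimately show "s \<in> set_of \<gamma>"
    using ne unfolding set_of_def by (auto simp: Suc_le_eq intro!: exI[of _ "length (concat (take k gs))"])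
qed

text \<open>Induction on \<open>\<beta>\<close>. Unless it is the only part, the first part is a
  partial sum of \<open>\<gamma>\<close>, so a prefix of \<open>\<gamma>\<close> serves as the first
  block. Subtracting that part from the later partial sums carries the inclusion over to the two
  tails.\<close>

lemma set_of_subset_imp_coarsening:
  assumes "composition n \<beta>" "composition n \<gamma>" "set_of \<beta> \<subseteq> set_of \<gamma>"
  shows "\<beta> \<succcurlyeq>\<^sub>c \<gamma>"
  using assms
proof (induction \<beta> arbitrary: n \<gamma>)
  case Nil
  then have "\<gamma> = []" by (cases \<gamma>) (auto simp: composition_def)
  then show ?case by (auto simp: coarsening_def)
next
  case (Cons b \<beta>)
  have b: "0 < b" using Cons.prems by (simp add: composition_def)
  show ?case
  proof (cases "\<beta> = []")
    case True
    then show ?thesis using Cons.prems b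
      by (auto simp: coarsening_def composition_def intro!: exI[of _ "[\<gamma>]"])
  next
    case False
    then have "b \<in> set_of (b # \<beta>)"
      by (auto simp: set_of_def intro!: exI[of _ 1])
    then obtain k where k: "b = psum \<gamma> k" "1 \<le> k" "k < length \<gamma>"
      using Cons.prems by (auto simp: set_of_def)
    let ?\<delta> = "drop k \<gamma>"
    have split: "sum_list \<gamma> = psum \<gamma> k + sum_list ?\<delta>"
      by (metis append_take_drop_id sum_list_append)
    have "composition (n - b) \<beta>" "composition (n - b) ?\<delta>"
      using Cons.prems split k by (auto simp: composition_def dest: in_set_dropD)
    moreover have "set_of \<beta> \<subseteq> set_of ?\<delta>"
    proof
      fix s assume "s \<in> set_of \<beta>"
      then obtain j where j: "s = psum \<beta> j" "1 \<le> j" "j < length \<beta>" by (auto simp: set_of_def)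
      have s: "0 < s" using \<open>s \<in> set_of \<beta>\<close> set_of_subset[OF \<open>composition (n - b) \<beta>\<close>] by auto
      have "b + s \<in> set_of (b # \<beta>)"
        using j by (auto simp: set_of_def intro!: exI[of _ "Suc j"])
      then obtain l where l: "b + s = psum \<gamma> l" "1 \<le> l" "l < length \<gamma>"
        using Cons.prems by (auto simp: set_of_def)
      \<comment> \<open>Otherwise monotonicity would give \<open>b + s \<le> b\<close>, although
        \<open>s\<close> is positive.\<close>
      have "k < l" using psum_mono[of l k \<gamma>] l k s by (cases "k < l") auto
      then have "take l \<gamma> = take k \<gamma> @ take (l - k) ?\<delta>"
        by (metis le_add_diff_inverse less_imp_le take_add)
      then have "s = psum ?\<delta> (l - k)" using l k by simp
      then show "s \<in> set_of ?\<delta>"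
        using \<open>k < l\<close> l by (auto simp: set_of_def intro!: exI[of _ "l - k"])
    qed
    ultimately have "\<beta> \<succcurlyeq>\<^sub>c ?\<delta>" by (rule Cons.IH)
    then obtain gs where "concat gs = ?\<delta>" "[] \<notin> set gs" "map sum_list gs = \<beta>"
      by (auto simp: coarsening_def)
    then show ?thesis using k
      by (auto simp: coarsening_def intro!: exI[of _ "take k \<gamma> # gs"])
  qed
qed

lemma coarsening_iff_set_of_subset:
  assumes "composition n \<beta>" "composition n \<gamma>"
  shows "\<beta> \<succcurlyeq>\<^sub>c \<gamma> \<longleftrightarrow> set_of \<beta> \<subseteq> set_of \<gamma>"
  using assms coarsening_imp_set_of_subset set_of_subset_imp_coarsening by blast

lemma comp_of_eq_iff:
  assumes "composition n \<beta>" "D \<subseteq> {1..<n}"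
  shows "comp_of n D = \<beta> \<longleftrightarrow> D = set_of \<beta>"
  using assms comp_of_set_of set_of_comp_of by metis

section \<open>Descent sets\<close>

lemma finite_diagram [simp]: "finite (diagram \<alpha>)"
  by (simp add: diagram_def)

lemma card_diagram: "card (diagram \<alpha>) = sum_list \<alpha>"
  by (simp add: diagram_def sum_list_sum_nth atLeast0LessThan)

lemma finite_standard_immaculate: "finite (standard_immaculate \<alpha>)"
proof (rule finite_subset)
  show "standard_immaculate \<alpha> \<subseteq> diagram \<alpha> \<rightarrow>\<^sub>E {1..sum_list \<alpha>}"
    by (auto simp: standard_immaculate_def PiE_def bij_betw_def simp del: One_nat_def)
qed (simp add: finite_PiE)

text \<open>Each of \<open>i\<close> and \<open>i + 1\<close> occupies exactly one cell when
  \<open>i\<close> is in \<open>{1..<sum_list \<alpha>}\<close>, and of two cells the second is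
  either strictly above or weakly below the first.\<close>

lemma
  assumes "T \<in> standard_immaculate \<alpha>"
  shows Des_S_subset: "Des_S \<alpha> T \<subseteq> {1..<sum_list \<alpha>}"
    and Des_RS_eq: "Des_RS \<alpha> T = {1..<sum_list \<alpha>} - Des_S \<alpha> T"
proof -
  let ?n = "sum_list \<alpha>"
  have bij: "bij_betw T (diagram \<alpha>) {1..?n}"
    using assms by (simp add: standard_immaculate_def)
  have range: "T x \<in> {1..?n}" if "x \<in> diagram \<alpha>" for x
    using bij that by (rule bij_betw_apply)
  have inj: "x = y" if "T x = T y" "x \<in> diagram \<alpha>" "y \<in> diagram \<alpha>" for x y
    using bij that by (auto simp: bij_betw_def dest: inj_onD)
  have cell: "\<exists>x\<in>diagram \<alpha>. T x = i" if "i \<in> {1..?n}" for i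
    using bij that unfolding bij_betw_def by (metis imageE)
  have bound: "i \<in> {1..<?n}" if "T x = i" "T y = i + 1" "x \<in> diagram \<alpha>" "y \<in> diagram \<alpha>" for i x y
    using range[of x] range[of y] that by auto
  show "Des_S \<alpha> T \<subseteq> {1..<?n}"
    unfolding Des_S_def using bound by blast
  show "Des_RS \<alpha> T = {1..<?n} - Des_S \<alpha> T"
  proof (intro equalityI subsetI)
    fix i assume "i \<in> Des_RS \<alpha> T"
    then obtain x y where xy: "x \<in> diagram \<alpha>" "y \<in> diagram \<alpha>" "T x = i" "T y = i + 1" "fst y \<le> fst x"
      by (auto simp: Des_RS_def)
    have "i \<notin> Des_S \<alpha> T"
    proof
      assume "i \<in> Des_S \<alpha> T"
      then obtain x' y' where "x' \<in> diagram \<alpha>" "y' \<in> diagram \<alpha>" "T x' = i" "T y' = i + 1"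
        "fst x' < fst y'"
        by (auto simp: Des_S_def)
      with xy inj[of x x'] inj[of y y'] show False by simp
    qed
    with xy bound show "i \<in> {1..<?n} - Des_S \<alpha> T" by blast
  next
    fix i assume i: "i \<in> {1..<?n} - Des_S \<alpha> T"
    then obtain x y where "x \<in> diagram \<alpha>" "T x = i" "y \<in> diagram \<alpha>" "T y = i + 1"
      using cell[of i] cell[of "i + 1"] by auto
    with i show "i \<in> Des_RS \<alpha> T"
      unfolding Des_S_def Des_RS_def by (metis (mono_tags, lifting) DiffD2 mem_Collect_eq not_le)
  qed
qed

text \<open>The two sides count the same tableaux, because the two descent sets of a tableau are
  complementary.\<close>

lemma L_num_comp_complement:
  assumes "composition n \<alpha>" "composition n \<beta>"
  shows "L_num \<alpha> (comp_complement \<beta>) = L_star \<alpha> \<beta>"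
proof -
  have n: "sum_list \<alpha> = n" "sum_list \<beta> = n" using assms by (auto simp: composition_def)
  let ?C = "{1..<n} - set_of \<beta>"
  have C: "composition n (comp_of n ?C)" "set_of (comp_of n ?C) = ?C"
    using set_of_comp_of[of ?C n] by auto
  have "comp_of n (Des_S \<alpha> T) = comp_of n ?C \<longleftrightarrow> comp_of n (Des_RS \<alpha> T) = \<beta>"
    if T: "T \<in> standard_immaculate \<alpha>" for T
  proof -
    have D: "Des_S \<alpha> T \<subseteq> {1..<n}" "Des_RS \<alpha> T = {1..<n} - Des_S \<alpha> T"
      using Des_S_subset[OF T] Des_RS_eq[OF T] n by auto
    have "comp_of n (Des_S \<alpha> T) = comp_of n ?C \<longleftrightarrow> Des_S \<alpha> T = ?C"
      using comp_of_eq_iff[OF C(1) D(1)] C(2) by simp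
    \<comment> \<open>Complementation in \<open>{1..<n}\<close> is an involution on its subsets, and
      both \<open>Des_S \<alpha> T\<close> and \<open>set_of \<beta>\<close> are such
      subsets.\<close>
    also have "\<dots> \<longleftrightarrow> Des_RS \<alpha> T = set_of \<beta>"
      using D set_of_subset[OF assms(2)] by auto
    also have "\<dots> \<longleftrightarrow> comp_of n (Des_RS \<alpha> T) = \<beta>"
      using comp_of_eq_iff[OF assms(2)] D(2) by blast
    finally show ?thesis .
  qed
  then show ?thesis
    unfolding L_num_def L_star_def comp_complement_def Let_def n
    by (intro arg_cong[where f = card]) blast
qed

text \<open>Each tableau has exactly one descent composition, so the sum is the size of a disjoint
  union over the coarsenings of \<open>\<gamma>\<close>.\<close>

lemma sum_L_star:
  assumes "composition n \<alpha>" "composition n \<gamma>"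
  shows "(\<Sum>\<beta> | composition n \<beta> \<and> \<beta> \<succcurlyeq>\<^sub>c \<gamma>. L_star \<alpha> \<beta>)
    = card {T \<in> standard_immaculate \<alpha>. Des_RS \<alpha> T \<subseteq> set_of \<gamma>}"
proof -
  have n: "sum_list \<alpha> = n" using assms by (simp add: composition_def)
  let ?B = "{\<beta>. composition n \<beta> \<and> \<beta> \<succcurlyeq>\<^sub>c \<gamma>}"
  let ?F = "\<lambda>\<beta>. {T \<in> standard_immaculate \<alpha>. comp_of n (Des_RS \<alpha> T) = \<beta>}"
  have B: "?B = {\<beta>. composition n \<beta> \<and> set_of \<beta> \<subseteq> set_of \<gamma>}"
    using coarsening_iff_set_of_subset assms by blast
  \<comment> \<open>The index set is finite because a coarsening is recovered from its set of
    partial sums, a subset of the finite set \<open>set_of \<gamma>\<close>.\<close>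
  have "?B \<subseteq> comp_of n ` Pow (set_of \<gamma>)"
    unfolding B by (auto intro: rev_image_eqI comp_of_set_of[symmetric])
  moreover have "finite (set_of \<gamma>)"
    using set_of_subset[OF assms(2)] finite_subset by blast
  ultimately have finB: "finite ?B" using finite_subset by blast
  have D: "Des_RS \<alpha> T \<subseteq> {1..<n}" if "T \<in> standard_immaculate \<alpha>" for T
    using Des_RS_eq[OF that] n by auto
  have "(\<Sum>\<beta>\<in>?B. L_star \<alpha> \<beta>) = (\<Sum>\<beta>\<in>?B. card (?F \<beta>))"
    by (simp add: L_star_def n)
  also have "\<dots> = card (\<Union>\<beta>\<in>?B. ?F \<beta>)"
    using finB by (subst card_UN_disjoint) (auto simp: finite_standard_immaculate)
  also have "(\<Union>\<beta>\<in>?B. ?F \<beta>) = {T \<in> standard_immaculate \<alpha>. Des_RS \<alpha> T \<subseteq> set_of \<gamma>}"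
    unfolding B using D set_of_comp_of by auto
  finally show ?thesis .
qed

section \<open>Standardization\<close>

text \<open>Blocks are counted from 1, so that the block index can serve directly as a tableau
  entry; \<open>m = 0\<close> gets index 0.\<close>

definition block_index :: "nat list \<Rightarrow> nat \<Rightarrow> nat" where
  "block_index \<gamma> m = (LEAST k. m \<le> psum \<gamma> k)"

text \<open>This is a Galois connection between block indices and partial sums. The bound on
  \<open>m\<close> guarantees that the least index is attained.\<close>

lemma block_index_le_iff:
  assumes "m \<le> sum_list \<gamma>"
  shows "block_index \<gamma> m \<le> k \<longleftrightarrow> m \<le> psum \<gamma> k"
proof
  have "m \<le> psum \<gamma> (length \<gamma>)" using assms by simp
  then have "m \<le> psum \<gamma> (block_index \<gamma> m)" unfolding block_index_def by (rule LeastI)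
  then show "block_index \<gamma> m \<le> k \<Longrightarrow> m \<le> psum \<gamma> k" using psum_mono le_trans by blast
qed (simp add: block_index_def Least_le)

lemma block_index_eq_Suc_iff:
  assumes "m \<le> sum_list \<gamma>"
  shows "block_index \<gamma> m = Suc k \<longleftrightarrow> psum \<gamma> k < m \<and> m \<le> psum \<gamma> (Suc k)"
  using block_index_le_iff[OF assms, of k] block_index_le_iff[OF assms, of "Suc k"] by linarith

lemma block_index_pos:
  assumes "0 < m" "m \<le> sum_list \<gamma>" shows "0 < block_index \<gamma> m"
  using assms block_index_le_iff[of m \<gamma> 0] by auto

lemma block_index_mono:
  assumes "m \<le> m'" "m' \<le> sum_list \<gamma>"
  shows "block_index \<gamma> m \<le> block_index \<gamma> m'"
  using assms block_index_le_iff[of m \<gamma>] block_index_le_iff[of m' \<gamma>] le_trans by blast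

text \<open>The proper partial sums are the last elements of the blocks other than the final one,
  which is where the block index jumps.\<close>

lemma mem_set_of_iff_block_index:
  assumes "composition n \<gamma>" "0 < m" "m < n"
  shows "m \<in> set_of \<gamma> \<longleftrightarrow> block_index \<gamma> m < block_index \<gamma> (Suc m)"
proof -
  have n: "sum_list \<gamma> = n" using assms by (simp add: composition_def)
  have le: "block_index \<gamma> m \<le> k \<longleftrightarrow> m \<le> psum \<gamma> k"
    "block_index \<gamma> (Suc m) \<le> k \<longleftrightarrow> Suc m \<le> psum \<gamma> k" for k
    using assms n block_index_le_iff[of m \<gamma>] block_index_le_iff[of "Suc m" \<gamma>] by simp_all
  show ?thesis
  proof
    assume "m \<in> set_of \<gamma>"
    then obtain k where "m = psum \<gamma> k" by (auto simp: set_of_def)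
    then have "block_index \<gamma> m \<le> k" "\<not> block_index \<gamma> (Suc m) \<le> k" using le by auto
    then show "block_index \<gamma> m < block_index \<gamma> (Suc m)" by simp
  next
    let ?k = "block_index \<gamma> m"
    assume "?k < block_index \<gamma> (Suc m)"
    \<comment> \<open>The connection at \<open>?k\<close> yields both
      \<open>m \<le> psum \<gamma> ?k\<close> and \<open>psum \<gamma> ?k < Suc m\<close>.\<close>
    then have m: "m = psum \<gamma> ?k" using le[of ?k] by simp
    have "0 < ?k" using assms n by (simp add: block_index_pos)
    moreover have "?k < length \<gamma>" using m assms n by (cases "?k < length \<gamma>") auto
    ultimately show "m \<in> set_of \<gamma>" using m unfolding set_of_def by auto
  qed
qed

definition weak_of :: "nat list \<Rightarrow> nat list \<Rightarrow> (nat \<times> nat \<Rightarrow> nat) \<Rightarrow> nat \<times> nat \<Rightarrow> nat" where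
  "weak_of \<alpha> \<gamma> T = (\<lambda>x\<in>diagram \<alpha>. block_index \<gamma> (T x))"

text \<open>This is the rank of a cell when cells are ordered by entry and then by row. In a
  row-strict tableau equal entries lie in different rows, so there are no ties.\<close>

definition standardize :: "nat list \<Rightarrow> (nat \<times> nat \<Rightarrow> nat) \<Rightarrow> nat \<times> nat \<Rightarrow> nat" where
  "standardize \<alpha> U =
    (\<lambda>x\<in>diagram \<alpha>. card {y \<in> diagram \<alpha>. U y < U x \<or> U y = U x \<and> fst y \<le> fst x})"

context
  fixes n \<alpha> \<gamma>
  assumes comp: "composition n \<alpha>" "composition n \<gamma>"
begin

section \<open>From standard tableaux to row-strict tableaux of content
  \<open>\<gamma>\<close>\<close>

lemma sums: "sum_list \<alpha> = n" "sum_list \<gamma> = n"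
  using comp by (auto simp: composition_def)

lemma psum_le_n: "psum \<gamma> k \<le> n"
  using psum_le[of k \<gamma>] sums by simp

text \<open>None of the values from \<open>T x\<close> to \<open>T y - 1\<close> ends a block, so
  none is a row-strict descent. Hence every step from \<open>m\<close> to \<open>m + 1\<close> on
  the way goes to a strictly higher row, and the steps compose by induction on
  \<open>m\<close>.\<close>

lemma same_block_rows_increase:
  assumes T: "T \<in> standard_immaculate \<alpha>" and D: "Des_RS \<alpha> T \<subseteq> set_of \<gamma>"
    and x: "x \<in> diagram \<alpha>" and y: "y \<in> diagram \<alpha>"
    and lt: "T x < T y" and eq: "block_index \<gamma> (T x) = block_index \<gamma> (T y)"
  shows "fst x < fst y"
proof -
  have bij: "bij_betw T (diagram \<alpha>) {1..n}"
    using T sums by (simp add: standard_immaculate_def)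
  have range: "T z \<in> {1..n}" if "z \<in> diagram \<alpha>" for z
    using bij that by (rule bij_betw_apply)
  have "\<forall>z\<in>diagram \<alpha>. T z = m \<longrightarrow> fst x < fst z" if "Suc (T x) \<le> m" "m \<le> T y" for m
    using that
  proof (induction m rule: nat_induct_at_least)
    case base
    show ?case
    proof (intro ballI impI)
      fix z assume z: "z \<in> diagram \<alpha>" "T z = Suc (T x)"
      have "block_index \<gamma> (Suc (T x)) \<le> block_index \<gamma> (T x)"
        unfolding eq using lt range[OF y] sums by (intro block_index_mono) auto
      then have "T x \<notin> set_of \<gamma>"
        using mem_set_of_iff_block_index[OF comp(2), of "T x"] range[OF x] range[OF z(1)] z by auto
      then show "fst x < fst z" using D x z by (fastforce simp: Des_RS_def)
    qed
  next
    case (Suc m)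
    show ?case
    proof (intro ballI impI)
      fix z assume z: "z \<in> diagram \<alpha>" "T z = Suc m"
      \<comment> \<open>The induction hypothesis speaks about cells with entry \<open>m\<close>;
        surjectivity of \<open>T\<close> supplies one.\<close>
      have "m \<in> T ` diagram \<alpha>" using bij Suc.hyps Suc.prems range[OF y] by (auto simp: bij_betw_def)
      then obtain w where w: "w \<in> diagram \<alpha>" "T w = m" by blast
      have "block_index \<gamma> (Suc m) \<le> block_index \<gamma> (T y)"
        using Suc.prems range[OF y] sums by (intro block_index_mono) auto
      also have "\<dots> \<le> block_index \<gamma> m"
        unfolding eq[symmetric] using Suc range[OF y] sums by (intro block_index_mono) auto
      finally have "m \<notin> set_of \<gamma>"
        using mem_set_of_iff_block_index[OF comp(2), of m] range[OF w(1)] range[OF z(1)] z w by auto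
      then have "fst w < fst z" using D w z by (fastforce simp: Des_RS_def)
      moreover have "fst x < fst w" using Suc w by simp
      ultimately show "fst x < fst z" by simp
    qed
  qed
  from this[of "T y"] show ?thesis using lt y by simp
qed

text \<open>Entries in different blocks are ordered by block, and within a block the rows increase
  with the entries. So ordering cells by block and then by row recovers the order of
  \<open>T\<close>.\<close>

lemma weak_of_less_iff:
  assumes T: "T \<in> standard_immaculate \<alpha>" and D: "Des_RS \<alpha> T \<subseteq> set_of \<gamma>"
    and x: "x \<in> diagram \<alpha>" and y: "y \<in> diagram \<alpha>"
  shows "weak_of \<alpha> \<gamma> T y < weak_of \<alpha> \<gamma> T x \<or>
      weak_of \<alpha> \<gamma> T y = weak_of \<alpha> \<gamma> T x \<and> fst y \<le> fst x \<longleftrightarrow> T y \<le> T x"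
proof -
  have bij: "bij_betw T (diagram \<alpha>) {1..n}"
    using T sums by (simp add: standard_immaculate_def)
  have range: "T z \<le> sum_list \<gamma>" if "z \<in> diagram \<alpha>" for z
    using bij_betw_apply[OF bij that] sums by simp
  have inj: "T x = T y \<Longrightarrow> x = y"
    using bij x y by (auto simp: bij_betw_def dest: inj_onD)
  consider "T x < T y" | "T y < T x" | "x = y" using inj by linarith
  then show ?thesis
  proof cases
    case 1
    then show ?thesis
      using block_index_mono[of "T x" "T y" \<gamma>] range[OF y] same_block_rows_increase[OF T D x y] x y
      by (auto simp: weak_of_def)
  next
    case 2
    then show ?thesis
      using block_index_mono[of "T y" "T x" \<gamma>] range[OF x] same_block_rows_increase[OF T D y x] x y
      by (auto simp: weak_of_def)
  qed simp
qed

lemma standardize_weak_of: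
  assumes T: "T \<in> standard_immaculate \<alpha>" and D: "Des_RS \<alpha> T \<subseteq> set_of \<gamma>"
  shows "standardize \<alpha> (weak_of \<alpha> \<gamma> T) = T"
proof (rule extensionalityI[where A = "diagram \<alpha>"])
  show "standardize \<alpha> (weak_of \<alpha> \<gamma> T) \<in> extensional (diagram \<alpha>)"
    by (simp add: standardize_def)
  show "T \<in> extensional (diagram \<alpha>)"
    using T by (simp add: standard_immaculate_def)
  fix x assume x: "x \<in> diagram \<alpha>"
  have bij: "bij_betw T (diagram \<alpha>) {1..n}"
    using T sums by (simp add: standard_immaculate_def)
  have xn: "T x \<le> n" using bij_betw_apply[OF bij x] by simp
  \<comment> \<open>The rank is computed with the order of \<open>T\<close> itself, and exactly
    \<open>T x\<close> of the values \<open>1, ..., n\<close> are at most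
    \<open>T x\<close>.\<close>
  have "standardize \<alpha> (weak_of \<alpha> \<gamma> T) x = card {y \<in> diagram \<alpha>. T y \<le> T x}"
    unfolding standardize_def using weak_of_less_iff[OF T D x] x
    by (auto intro!: arg_cong[where f = card])
  also have "\<dots> = card (T ` {y \<in> diagram \<alpha>. T y \<le> T x})"
    using bij by (intro card_image[symmetric]) (auto simp: bij_betw_def inj_on_def)
  also have "T ` {y \<in> diagram \<alpha>. T y \<le> T x} = {z \<in> T ` diagram \<alpha>. z \<le> T x}"
    by blast
  also have "\<dots> = {1..T x}"
    using bij xn by (auto simp: bij_betw_def)
  finally show "standardize \<alpha> (weak_of \<alpha> \<gamma> T) x = T x" by simp
qed

lemma weak_of_row_strict:
  assumes T: "T \<in> standard_immaculate \<alpha>" and D: "Des_RS \<alpha> T \<subseteq> set_of \<gamma>"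
  shows "weak_of \<alpha> \<gamma> T \<in> row_strict_immaculate \<alpha>"
proof -
  have bij: "bij_betw T (diagram \<alpha>) {1..n}"
    using T sums by (simp add: standard_immaculate_def)
  have range: "T z \<in> {1..n}" if "z \<in> diagram \<alpha>" for z
    using bij that by (rule bij_betw_apply)
  have mono: "weak_of \<alpha> \<gamma> T x \<le> weak_of \<alpha> \<gamma> T y"
    if "x \<in> diagram \<alpha>" "y \<in> diagram \<alpha>" "T x < T y" for x y
    using that range[of y] sums by (simp add: weak_of_def block_index_mono)
  have "weak_of \<alpha> \<gamma> T \<in> diagram \<alpha> \<rightarrow>\<^sub>E {1..}"
  proof
    fix x assume "x \<in> diagram \<alpha>"
    then show "weak_of \<alpha> \<gamma> T x \<in> {1..}"
      using range[of x] block_index_pos[of "T x" \<gamma>] sums by (simp add: weak_of_def)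
  qed (simp add: weak_of_def)
  moreover have "T (r, 0) < T (s, 0)"
    if "(r, 0) \<in> diagram \<alpha>" "(s, 0) \<in> diagram \<alpha>" "r < s" for r s
    using T that by (auto simp: standard_immaculate_def)
  moreover have "rows_strict \<alpha> (weak_of \<alpha> \<gamma> T)"
    unfolding rows_strict_def
  proof (intro allI impI)
    fix r c d assume cd: "(r, c) \<in> diagram \<alpha>" "(r, d) \<in> diagram \<alpha>" "c < d"
    then have "T (r, c) < T (r, d)"
      using T by (auto simp: standard_immaculate_def rows_strict_def)
    \<comment> \<open>Both cells lie in row \<open>r\<close>, so the row condition in the
      equivalence holds and a tie between block indices would force
      \<open>T (r, d) \<le> T (r, c)\<close>.\<close>
    then show "weak_of \<alpha> \<gamma> T (r, c) < weak_of \<alpha> \<gamma> T (r, d)"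
      using weak_of_less_iff[OF T D cd(1,2)] by auto
  qed
  ultimately show ?thesis
    unfolding row_strict_immaculate_def using mono by blast
qed

lemma weak_of_has_content:
  assumes T: "T \<in> standard_immaculate \<alpha>"
  shows "has_content \<alpha> (weak_of \<alpha> \<gamma> T) \<gamma>"
  unfolding has_content_def
proof (intro allI impI)
  fix i :: nat assume "1 \<le> i"
  then obtain k where i: "i = Suc k" by (cases i) auto
  have bij: "bij_betw T (diagram \<alpha>) {1..n}"
    using T sums by (simp add: standard_immaculate_def)
  have "{x \<in> diagram \<alpha>. weak_of \<alpha> \<gamma> T x = i} = {x \<in> diagram \<alpha>. block_index \<gamma> (T x) = i}"
    by (auto simp: weak_of_def)
  then have "card {x \<in> diagram \<alpha>. weak_of \<alpha> \<gamma> T x = i} =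
    card {x \<in> diagram \<alpha>. block_index \<gamma> (T x) = i}" by simp
  also have "\<dots> = card (T ` {x \<in> diagram \<alpha>. block_index \<gamma> (T x) = i})"
    using bij by (intro card_image[symmetric]) (auto simp: bij_betw_def inj_on_def)
  also have "T ` {x \<in> diagram \<alpha>. block_index \<gamma> (T x) = i} = {m \<in> T ` diagram \<alpha>. block_index \<gamma> m = i}"
    by blast
  also have "\<dots> = {psum \<gamma> k<..psum \<gamma> (Suc k)}"
    using bij psum_le_n[of "Suc k"] block_index_eq_Suc_iff[of _ \<gamma> k] sums i
    by (auto simp: bij_betw_def simp del: take_Suc)
  \<comment> \<open>Past the last part the partial sums are constant, so the interval is empty and
    the default value 0 results.\<close>
  also have "card \<dots> = (if i \<le> length \<gamma> then \<gamma> ! (i - 1) else 0)"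
    using i by (simp add: psum_Suc)
  finally show "card {x \<in> diagram \<alpha>. weak_of \<alpha> \<gamma> T x = i}
    = (if i \<le> length \<gamma> then \<gamma> ! (i - 1) else 0)" .
qed

section \<open>From row-strict tableaux back to standard ones\<close>

lemma
  assumes U: "U \<in> row_strict_immaculate \<alpha>"
  shows standardize_less: "\<And>x y. x \<in> diagram \<alpha> \<Longrightarrow> y \<in> diagram \<alpha> \<Longrightarrow>
      U x < U y \<or> U x = U y \<and> fst x < fst y \<Longrightarrow> standardize \<alpha> U x < standardize \<alpha> U y"
    and standardize_standard: "standardize \<alpha> U \<in> standard_immaculate \<alpha>"
proof -
  let ?T = "standardize \<alpha> U"
  let ?S = "\<lambda>x. {y \<in> diagram \<alpha>. U y < U x \<or> U y = U x \<and> fst y \<le> fst x}"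
  have rs: "rows_strict \<alpha> U" using U by (simp add: row_strict_immaculate_def)
  show less: "?T x < ?T y" if "x \<in> diagram \<alpha>" "y \<in> diagram \<alpha>"
    "U x < U y \<or> U x = U y \<and> fst x < fst y" for x y
  proof -
    have "?S x \<subseteq> ?S y" using that by auto
    moreover have "y \<in> ?S y" "y \<notin> ?S x" using that by auto
    ultimately have "?S x \<subset> ?S y" by blast
    then show ?thesis using that by (simp add: standardize_def psubset_card_mono)
  qed
  \<comment> \<open>Row-strictness makes the order by entry and row total on cells, which is what
    injectivity of the rank requires.\<close>
  have tri: "x = y" if "x \<in> diagram \<alpha>" "y \<in> diagram \<alpha>" "U x = U y" "fst x = fst y" for x y
    using that rs unfolding rows_strict_def
    by (metis less_irrefl linorder_less_linear prod.collapse)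
  have inj: "inj_on ?T (diagram \<alpha>)"
  proof (rule inj_onI)
    fix x y assume xy: "x \<in> diagram \<alpha>" "y \<in> diagram \<alpha>" "?T x = ?T y"
    then show "x = y"
      using less[of x y] less[of y x] tri[of x y] by (metis less_irrefl linorder_less_linear)
  qed
  have sub: "?T ` diagram \<alpha> \<subseteq> {1..sum_list \<alpha>}"
  proof clarify
    fix x assume x: "x \<in> diagram \<alpha>"
    have "card (?S x) \<le> card (diagram \<alpha>)" by (intro card_mono) auto
    moreover have "x \<in> ?S x" "finite (?S x)" using x by simp_all
    then have "0 < card (?S x)" unfolding card_gt_0_iff by blast
    ultimately show "?T x \<in> {1..sum_list \<alpha>}"
      using x by (simp add: standardize_def card_diagram)
  qed
  have "?T ` diagram \<alpha> = {1..sum_list \<alpha>}"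
    using sub by (rule card_subset_eq[rotated]) (auto simp: card_image[OF inj] card_diagram)
  then have "bij_betw ?T (diagram \<alpha>) {1..sum_list \<alpha>}"
    using inj by (simp add: bij_betw_def)
  moreover have "rows_strict \<alpha> ?T"
    using rs less unfolding rows_strict_def by blast
  moreover have "?T (r, 0) < ?T (s, 0)"
    if "(r, 0) \<in> diagram \<alpha>" "(s, 0) \<in> diagram \<alpha>" "r < s" for r s
  proof -
    have "U (r, 0) \<le> U (s, 0)" using U that by (auto simp: row_strict_immaculate_def)
    \<comment> \<open>A tie in the first column is broken by the row, turning weak increase into
      strict increase.\<close>
    then show ?thesis using that by (intro less) auto
  qed
  ultimately show "?T \<in> standard_immaculate \<alpha>"
    by (simp add: standard_immaculate_def standardize_def)
qed

lemma card_entries_le: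
  assumes U: "U \<in> row_strict_immaculate \<alpha>" and C: "has_content \<alpha> U \<gamma>"
  shows "card {y \<in> diagram \<alpha>. U y \<le> k} = psum \<gamma> k"
proof (induction k)
  case 0
  \<comment> \<open>\<open>has_content\<close> is silent about the value 0; it is excluded by the
    positivity of the entries.\<close>
  have "\<forall>y\<in>diagram \<alpha>. 0 < U y" using U by (auto simp: row_strict_immaculate_def PiE_iff Suc_le_eq)
  then have "{y \<in> diagram \<alpha>. U y \<le> 0} = {}" by auto
  then show ?case by simp
next
  case (Suc k)
  have "{y \<in> diagram \<alpha>. U y \<le> Suc k} = {y \<in> diagram \<alpha>. U y \<le> k} \<union> {y \<in> diagram \<alpha>. U y = Suc k}"
    by auto
  also have "card \<dots> = psum \<gamma> k + card {y \<in> diagram \<alpha>. U y = Suc k}"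
    using Suc by (subst card_Un_disjoint) auto
  also have "\<dots> = psum \<gamma> (Suc k)"
    using C by (simp add: has_content_def psum_Suc Suc_le_eq)
  finally show ?case .
qed

text \<open>A cell with entry \<open>k + 1\<close> ranks after all cells with entries at most
  \<open>k\<close> and among those with entries at most \<open>k + 1\<close>. By the content these
  are \<open>psum \<gamma> k\<close> and \<open>psum \<gamma> (k + 1)\<close> cells, the two bounds
  of block \<open>k + 1\<close>.\<close>

lemma block_index_standardize:
  assumes U: "U \<in> row_strict_immaculate \<alpha>" and C: "has_content \<alpha> U \<gamma>" and x: "x \<in> diagram \<alpha>"
  shows "block_index \<gamma> (standardize \<alpha> U x) = U x"
proof -
  let ?S = "{y \<in> diagram \<alpha>. U y < U x \<or> U y = U x \<and> fst y \<le> fst x}"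
  have S: "standardize \<alpha> U x = card ?S" using x by (simp add: standardize_def)
  have "0 < U x" using U x by (auto simp: row_strict_immaculate_def PiE_iff Suc_le_eq)
  then obtain k where k: "U x = Suc k" by (cases "U x") auto
  have "{y \<in> diagram \<alpha>. U y \<le> k} \<subseteq> ?S" "x \<in> ?S" "x \<notin> {y \<in> diagram \<alpha>. U y \<le> k}"
    using x k by auto
  then have "card {y \<in> diagram \<alpha>. U y \<le> k} < card ?S"
    by (intro psubset_card_mono psubsetI) (simp, assumption, blast)
  moreover have "card ?S \<le> card {y \<in> diagram \<alpha>. U y \<le> Suc k}"
    using k by (intro card_mono) auto
  ultimately have "psum \<gamma> k < card ?S \<and> card ?S \<le> psum \<gamma> (Suc k)"
    using card_entries_le[OF U C] by metis
  moreover have "card ?S \<le> sum_list \<gamma>"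
    using calculation psum_le[of "Suc k" \<gamma>] by linarith
  ultimately show ?thesis
    using block_index_eq_Suc_iff S k by simp
qed

lemma weak_of_standardize:
  assumes U: "U \<in> row_strict_immaculate \<alpha>" and C: "has_content \<alpha> U \<gamma>"
  shows "weak_of \<alpha> \<gamma> (standardize \<alpha> U) = U"
proof (rule extensionalityI[where A = "diagram \<alpha>"])
  show "U \<in> extensional (diagram \<alpha>)" using U by (auto simp: row_strict_immaculate_def PiE_def)
qed (auto simp: weak_of_def block_index_standardize[OF U C])

text \<open>Equal entries are numbered upwards, so a step to a weakly lower row must pass to a
  larger entry of \<open>U\<close>. The entries of \<open>U\<close> are the block indices of the
  ranks, so such a step leaves a block.\<close>

lemma Des_RS_standardize:
  assumes U: "U \<in> row_strict_immaculate \<alpha>" and C: "has_content \<alpha> U \<gamma>"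
  shows "Des_RS \<alpha> (standardize \<alpha> U) \<subseteq> set_of \<gamma>"
proof
  let ?T = "standardize \<alpha> U"
  fix i assume i: "i \<in> Des_RS \<alpha> ?T"
  then obtain x y where xy: "x \<in> diagram \<alpha>" "y \<in> diagram \<alpha>" "?T x = i" "?T y = i + 1" "fst y \<le> fst x"
    by (auto simp: Des_RS_def)
  have "U x < U y"
  proof (rule ccontr)
    assume "\<not> U x < U y"
    moreover have "\<not> ?T y < ?T x" using xy by simp
    then have "\<not> (U y < U x \<or> U y = U x \<and> fst y < fst x)"
      using standardize_less[OF U xy(2,1)] by blast
    ultimately have "U x = U y" "fst x = fst y" using xy by auto
    then have "?T x = ?T y" using xy(1,2) by (simp add: standardize_def)
    then show False using xy by simp
  qed
  then have "block_index \<gamma> i < block_index \<gamma> (Suc i)"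
    using block_index_standardize[OF U C] xy by (metis Suc_eq_plus1)
  moreover have "i \<in> {1..<n}"
    using i Des_RS_eq[OF standardize_standard[OF U]] sums by auto
  ultimately show "i \<in> set_of \<gamma>"
    using mem_set_of_iff_block_index[OF comp(2), of i] by auto
qed

lemma K_star_eq_card:
  "K_star \<alpha> \<gamma> = card {T \<in> standard_immaculate \<alpha>. Des_RS \<alpha> T \<subseteq> set_of \<gamma>}"
proof -
  have "bij_betw (weak_of \<alpha> \<gamma>) {T \<in> standard_immaculate \<alpha>. Des_RS \<alpha> T \<subseteq> set_of \<gamma>}
    {U \<in> row_strict_immaculate \<alpha>. has_content \<alpha> U \<gamma>}"
    by (rule bij_betw_byWitness[where f' = "standardize \<alpha>"])
      (auto simp: standardize_weak_of weak_of_standardize weak_of_row_strict weak_of_has_content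
        standardize_standard dest: Des_RS_standardize)
  then show ?thesis
    unfolding K_star_def by (simp add: bij_betw_same_card)
qed

end

theorem theorem3p9:
  fixes n :: nat and \<alpha> \<gamma> :: "nat list"
  assumes "composition n \<alpha>" and "composition n \<gamma>"
    and "ord_class.lexordp_eq \<gamma> \<alpha>"
  shows "K_star \<alpha> \<gamma> = (\<Sum>\<beta> | composition n \<beta> \<and> \<beta> \<succcurlyeq>\<^sub>c \<gamma>. L_num \<alpha> (comp_complement \<beta>))
    \<and> (\<Sum>\<beta> | composition n \<beta> \<and> \<beta> \<succcurlyeq>\<^sub>c \<gamma>. L_num \<alpha> (comp_complement \<beta>))
      = (\<Sum>\<beta> | composition n \<beta> \<and> \<beta> \<succcurlyeq>\<^sub>c \<gamma>. L_star \<alpha> \<beta>)"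
  using assms(1,2)
  by (simp add: L_num_comp_complement sum_L_star K_star_eq_card)

end
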